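(* Let $n\ge 1$, let $A,B\in\mathbb{M}_n^+$ and let $0<x<1$. Then, for all real numbers $p,q$ with $p\ge 1\ge q\ge 0$, $$ \left\{\mathrm{Tr}\,A^{pq}+\mathrm{Tr}\,B^{pq}\right\}^{1/p}\le \left\{\mathrm{Tr}\,(xA+(1-x)B)^{pq}\right\}^{1/p}+\left\{\mathrm{Tr}\,((1-x)A+xB)^{pq}\right\}^{1/p}. $$
   Context: $\mathbb{M}_n$ is the space of $n\times n$ complex matrices, and $\mathbb{M}_n^+$ is the cone of positive semidefinite matrices in $\mathbb{M}_n$. Powers of positive semidefinite matrices are defined by functional calculus, with the convention $Z^0=I$. $\mathrm{Tr}$ is the usual trace. *)

theory Defs
  imports "Jordan_Normal_Form.Schur_Decomposition"
begin

definition mat_trace :: "'a :: comm_monoid_add mat \<Rightarrow> 'a" where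
  "mat_trace Z = (\<Sum>i<dim_row Z. Z $$ (i, i))"

text \<open>The cone of positive semidefinite matrices.  The inequality is the order of
  \<^theory>\<open>HOL-Library.Complex_Order\<close>: the number \<open>v\<^sup>* Z v\<close> is real and nonnegative.\<close>

definition psd_cone :: "nat \<Rightarrow> complex mat set" where
  "psd_cone n = {Z \<in> carrier_mat n n. mat_adjoint Z = Z \<and>
     (\<forall>v \<in> carrier_vec n. 0 \<le> (Z *\<^sub>v v) \<bullet>c v)}"

definition unitary_mat :: "nat \<Rightarrow> complex mat \<Rightarrow> bool" where
  "unitary_mat n U \<longleftrightarrow> U \<in> carrier_mat n n \<and>
     mat_adjoint U * U = 1\<^sub>m n \<and> U * mat_adjoint U = 1\<^sub>m n"

definition unitary_conj_diag :: "nat \<Rightarrow> complex mat \<Rightarrow> (nat \<Rightarrow> real) \<Rightarrow> complex mat" where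
  "unitary_conj_diag n U d = U * mat_diag n (\<lambda>i. complex_of_real (d i)) * mat_adjoint U"

text \<open>Functional calculus \<open>f(Z) = U diag(f(d\<^sub>0), \<dots>, f(d\<^sub>n\<^sub>-\<^sub>1)) U\<^sup>*\<close> for a Hermitian matrix
  \<open>Z = U diag(d\<^sub>0, \<dots>, d\<^sub>n\<^sub>-\<^sub>1) U\<^sup>*\<close>.  A diagonalisation exists by the spectral theorem, and
  the result does not depend on its choice (\<open>unitary_conj_diag_fun_unique\<close> below).
  On non-Hermitian matrices the value is unspecified.\<close>

definition hermitian_fun :: "(real \<Rightarrow> real) \<Rightarrow> complex mat \<Rightarrow> complex mat" where
  "hermitian_fun f Z = (THE W. \<exists>U d. unitary_mat (dim_row Z) U \<and>
     Z = unitary_conj_diag (dim_row Z) U d \<and> W = unitary_conj_diag (dim_row Z) U (f \<circ> d))"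

text \<open>Since \<open>0 powr 0 = 0\<close>, the convention \<open>Z\<^sup>0 = I\<close> needs the case distinction.\<close>

definition psd_power :: "complex mat \<Rightarrow> real \<Rightarrow> complex mat" where
  "psd_power Z r = hermitian_fun (\<lambda>t. if r = 0 then 1 else t powr r) Z"

lemma mat_adjoint_carrier:
  "U \<in> carrier_mat n m \<Longrightarrow> mat_adjoint U \<in> carrier_mat m n"
  unfolding mat_adjoint_def carrier_mat_def by auto

lemma unitary_conj_diag_fun_unique:
  assumes U: "unitary_mat n U" and V: "unitary_mat n V"
    and eq: "unitary_conj_diag n U d = unitary_conj_diag n V e"
  shows "unitary_conj_diag n U (f \<circ> d) = unitary_conj_diag n V (f \<circ> e)"
proof -
  define D where "D g = mat_diag n (\<lambda>i. complex_of_real (g i))" for g :: "nat \<Rightarrow> real"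
  define W where "W = mat_adjoint V * U"
  have c: "U \<in> carrier_mat n n" "V \<in> carrier_mat n n" "mat_adjoint U \<in> carrier_mat n n"
    "mat_adjoint V \<in> carrier_mat n n" "D g \<in> carrier_mat n n" for g
    using U V by (auto simp: unitary_mat_def D_def mat_adjoint_carrier)
  have W: "W \<in> carrier_mat n n" using c by (simp add: W_def)
  have u: "mat_adjoint U * U = 1\<^sub>m n" "U * mat_adjoint U = 1\<^sub>m n"
    "mat_adjoint V * V = 1\<^sub>m n" "V * mat_adjoint V = 1\<^sub>m n"
    using U V by (auto simp: unitary_mat_def)
  note assoc = assoc_mult_mat[of _ n n _ n _ n]
  note closed = mult_carrier_mat[of _ n n _ n]
  have VW: "V * W = U" unfolding W_def
    using c u by (simp add: assoc[symmetric])
  have WU: "W * mat_adjoint U = mat_adjoint V" unfolding W_def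
    using c u by (simp add: assoc)
  have "W * D d = mat_adjoint V * (U * D d * mat_adjoint U) * U"
  proof -
    have "mat_adjoint V * (U * D d * mat_adjoint U) * U
        = mat_adjoint V * (U * (D d * (mat_adjoint U * U)))"
      using c by (simp add: assoc closed)
    then show ?thesis using c u
      by (simp add: W_def assoc closed right_mult_one_mat[of _ n n])
  qed
  also have "\<dots> = mat_adjoint V * (V * D e * mat_adjoint V) * U"
    using eq by (simp add: unitary_conj_diag_def D_def)
  also have "\<dots> = D e * W"
  proof -
    have "mat_adjoint V * (V * D e * mat_adjoint V) * U
        = (mat_adjoint V * V) * (D e * (mat_adjoint V * U))"
      using c by (simp add: assoc closed)
    then show ?thesis using c u W
      by (simp add: W_def closed left_mult_one_mat[of _ n n])
  qed
  finally have WD: "W * D d = D e * W" .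
  have entry: "(W * D g) $$ (i, j) = W $$ (i, j) * complex_of_real (g j)"
    "(D g * W) $$ (i, j) = complex_of_real (g i) * W $$ (i, j)"
    if "i < n" "j < n" for g i j
    using that W by (simp_all add: D_def mat_diag_mult_left[of _ n n] mat_diag_mult_right[of _ n n])
  have "W * D (f \<circ> d) = D (f \<circ> e) * W"
  proof (rule eq_matI)
    fix i j
    assume "i < dim_row (D (f \<circ> e) * W)" "j < dim_col (D (f \<circ> e) * W)"
    then have ij: "i < n" "j < n" using W by (auto simp: D_def mat_diag_def)
    have "W $$ (i, j) * complex_of_real (d j) = complex_of_real (e i) * W $$ (i, j)"
      using arg_cong[OF WD, of "\<lambda>M. M $$ (i, j)"] entry[OF ij] by simp
    then have "W $$ (i, j) = 0 \<or> d j = e i" by (auto simp: mult.commute)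
    then show "(W * D (f \<circ> d)) $$ (i, j) = (D (f \<circ> e) * W) $$ (i, j)"
      using entry[OF ij] by auto
  qed (use W in \<open>auto simp: D_def mat_diag_def\<close>)
  then have "V * (W * D (f \<circ> d)) * mat_adjoint U = V * (D (f \<circ> e) * W) * mat_adjoint U"
    by simp
  moreover have "V * (W * D (f \<circ> d)) * mat_adjoint U = U * D (f \<circ> d) * mat_adjoint U"
    using c W by (simp add: assoc closed flip: VW)
  moreover have "V * (D (f \<circ> e) * W) * mat_adjoint U = V * D (f \<circ> e) * mat_adjoint V"
    using c W WU by (simp add: assoc closed)
  ultimately show ?thesis by (simp add: unitary_conj_diag_def D_def)
qed

lemma hermitian_fun_eq:
  assumes "unitary_mat n U"
  shows "hermitian_fun f (unitary_conj_diag n U d) = unitary_conj_diag n U (f \<circ> d)"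
proof -
  have "dim_row (unitary_conj_diag n U d) = n"
    using assms by (auto simp: unitary_conj_diag_def unitary_mat_def)
  then have "hermitian_fun f (unitary_conj_diag n U d) = (THE W. \<exists>V e. unitary_mat n V \<and>
      unitary_conj_diag n U d = unitary_conj_diag n V e \<and> W = unitary_conj_diag n V (f \<circ> e))"
    by (simp only: hermitian_fun_def)
  also have "\<dots> = unitary_conj_diag n U (f \<circ> d)"
  proof (rule the_equality)
    show "\<exists>V e. unitary_mat n V \<and> unitary_conj_diag n U d = unitary_conj_diag n V e \<and>
        unitary_conj_diag n U (f \<circ> d) = unitary_conj_diag n V (f \<circ> e)"
      using assms by blast
  next
    fix W
    assume "\<exists>V e. unitary_mat n V \<and> unitary_conj_diag n U d = unitary_conj_diag n V e \<and>
        W = unitary_conj_diag n V (f \<circ> e)"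
    then obtain V e where V: "unitary_mat n V"
      and "unitary_conj_diag n U d = unitary_conj_diag n V e"
      and "W = unitary_conj_diag n V (f \<circ> e)" by blast
    with unitary_conj_diag_fun_unique[OF assms V] show "W = unitary_conj_diag n U (f \<circ> d)"
      by metis
  qed
  finally show ?thesis .
qed

end

theory Submission
  imports Defs "HOL-Analysis.Convex" "Jordan_Normal_Form.Spectral_Radius"
begin

text \<open>Write \<open>r = p q\<close>, \<open>C = x A + (1 - x) B\<close> and \<open>D = (1 - x) A + x B\<close>, so that
  \<open>C + D = A + B\<close>. The argument depends on which side of \<open>1\<close> the exponent \<open>r\<close> lies.

  If \<open>r \<le> 1\<close>, then \<open>Tr Z\<^sup>r\<close> is concave in \<open>Z\<close> (\<open>trace_power_concave\<close>). In the sum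
  of the concavity estimates for \<open>C\<close> and \<open>D\<close> the weights \<open>x\<close> and \<open>1 - x\<close> add up to one, so
  \<open>Tr A\<^sup>r + Tr B\<^sup>r \<le> Tr C\<^sup>r + Tr D\<^sup>r\<close>. The power \<open>1/p \<le> 1\<close> is increasing and subadditive, which
  gives the claim.

  If \<open>r > 1\<close>, then \<open>Tr Z\<^sup>r\<close> is superadditive (\<open>trace_power_superadditive\<close>), so
  \<open>Tr A\<^sup>r + Tr B\<^sup>r \<le> Tr (A + B)\<^sup>r = Tr (C + D)\<^sup>r\<close>. The triangle inequality for the Schatten
  \<open>r\<close>-norm (\<open>trace_power_Minkowski\<close>) bounds the \<open>1/r\<close>-th power of the right-hand side by the
  sum of the norms of \<open>C\<close> and \<open>D\<close>. Raising to the power \<open>q \<le> 1\<close>, which is again subadditive,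
  finishes the proof, as \<open>q/r = 1/p\<close>.

  Concavity and the triangle inequality both follow from the scalar statements through Peierls'
  inequality (\<open>Peierls_inequality\<close>), which compares the quadratic form of a Hermitian matrix on
  an arbitrary orthonormal basis with its eigenvalues. Superadditivity rests on a similar
  argument with a substochastic instead of a doubly stochastic matrix of overlaps
  (\<open>trace_power_le_weighted_quad_form\<close>).\<close>

(* The dot is reserved for the bilinear product of coordinate vectors. *)
no_notation inner (infixl \<open>\<bullet>\<close> 70)

section \<open>Adjoints and unitary matrices\<close>

lemma complex_mult_cnj_cmod: "z * cnj z = (complex_of_real (cmod z))\<^sup>2"
  by (metis complex_norm_square of_real_power)

lemma mat_adjoint_dim [simp]:
  "dim_row (mat_adjoint A) = dim_col A" "dim_col (mat_adjoint A) = dim_row A"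
  by (auto simp: mat_adjoint_def)

lemma mat_adjoint_index [simp]:
  fixes A :: "complex mat"
  assumes "i < dim_col A" "j < dim_row A"
  shows "mat_adjoint A $$ (i, j) = cnj (A $$ (j, i))"
  using assms by (simp add: mat_adjoint_def mat_of_rows_index)

lemma mat_adjoint_adjoint [simp]: "mat_adjoint (mat_adjoint A) = (A :: complex mat)"
  by (rule eq_matI) auto

lemma mat_adjoint_mult:
  fixes A B :: "complex mat"
  assumes "A \<in> carrier_mat n m" "B \<in> carrier_mat m k"
  shows "mat_adjoint (A * B) = mat_adjoint B * mat_adjoint A"
  using assms by (intro eq_matI) (auto simp: scalar_prod_def intro!: sum.cong)

lemma mat_adjoint_cscalar:
  fixes M :: "complex mat"
  assumes "M \<in> carrier_mat n m" "a \<in> carrier_vec m" "b \<in> carrier_vec n"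
  shows "(M *\<^sub>v a) \<bullet>c b = a \<bullet>c (mat_adjoint M *\<^sub>v b)"
proof -
  have "(M *\<^sub>v a) \<bullet>c b = (\<Sum>i<n. \<Sum>j<m. M $$ (i, j) * a $ j * cnj (b $ i))"
    using assms by (auto simp: scalar_prod_def sum_distrib_right lessThan_atLeast0 intro!: sum.cong)
  also have "\<dots> = (\<Sum>j<m. \<Sum>i<n. M $$ (i, j) * a $ j * cnj (b $ i))"
    by (rule sum.swap)
  also have "\<dots> = a \<bullet>c (mat_adjoint M *\<^sub>v b)"
    using assms by (auto simp: scalar_prod_def sum_distrib_left lessThan_atLeast0 intro!: sum.cong)
  finally show ?thesis .
qed

lemma mat_adjoint_mult_vec_index:
  fixes U :: "complex mat"
  assumes "U \<in> carrier_mat n m" "v \<in> carrier_vec n" "j < m"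
  shows "(mat_adjoint U *\<^sub>v v) $ j = v \<bullet>c col U j"
  using assms by (auto simp: scalar_prod_def intro!: sum.cong)

lemma cmod_cscalar_commute:
  fixes v w :: "complex vec"
  assumes "v \<in> carrier_vec n" "w \<in> carrier_vec n"
  shows "cmod (v \<bullet>c w) = cmod (w \<bullet>c v)"
proof -
  have "cnj (v \<bullet>c w) = w \<bullet>c v"
    using assms by (auto simp: scalar_prod_def intro!: sum.cong)
  then show ?thesis by (metis complex_mod_cnj)
qed

lemma unitary_matI_cols:
  assumes "U \<in> carrier_mat n n"
    and "\<And>i j. i < n \<Longrightarrow> j < n \<Longrightarrow> col U i \<bullet>c col U j = (if i = j then 1 else 0)"
  shows "unitary_mat n U"
proof -
  have adj: "mat_adjoint U \<in> carrier_mat n n"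
    using assms(1) by (rule mat_adjoint_carrier)
  have "mat_adjoint U * U = 1\<^sub>m n"
  proof (rule eq_matI)
    fix i j assume "i < dim_row (1\<^sub>m n :: complex mat)" "j < dim_col (1\<^sub>m n :: complex mat)"
    then have ij: "i < n" "j < n" by auto
    have "(mat_adjoint U * U) $$ (i, j) = col U j \<bullet>c col U i"
      using ij assms(1) by (auto simp: scalar_prod_def intro!: sum.cong)
    then show "(mat_adjoint U * U) $$ (i, j) = 1\<^sub>m n $$ (i, j)"
      using assms(2)[OF ij(2) ij(1)] ij by auto
  qed (use assms(1) in auto)
  then show ?thesis
    using mat_mult_left_right_inverse[OF adj assms(1)] assms(1) by (simp add: unitary_mat_def)
qed

lemma unitary_mat_orthonormal_cols:
  assumes "unitary_mat n U" "i < n" "j < n"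
  shows "col U i \<bullet>c col U j = (if i = j then 1 else 0)"
proof -
  have "col U i \<bullet>c col U j = (mat_adjoint U * U) $$ (j, i)"
    using carrier_matD[of U n n] assms(2,3) assms(1)[unfolded unitary_mat_def, THEN conjunct1]
    by (auto simp: scalar_prod_def intro!: sum.cong)
  also have "\<dots> = 1\<^sub>m n $$ (j, i)" using assms(1) by (simp add: unitary_mat_def)
  finally show ?thesis using assms by auto
qed

lemma unitary_col_carrier: "unitary_mat n U \<Longrightarrow> col U i \<in> carrier_vec n"
  by (rule carrier_vecI) (metis carrier_matD(1) dim_col unitary_mat_def)

lemma unitary_mat_mult:
  assumes "unitary_mat n U" "unitary_mat n V"
  shows "unitary_mat n (U * V)"
proof -
  have c: "U \<in> carrier_mat n n" "V \<in> carrier_mat n n" "mat_adjoint U \<in> carrier_mat n n"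
    "mat_adjoint V \<in> carrier_mat n n"
    and u: "mat_adjoint U * U = 1\<^sub>m n" "U * mat_adjoint U = 1\<^sub>m n"
    "mat_adjoint V * V = 1\<^sub>m n" "V * mat_adjoint V = 1\<^sub>m n"
    using assms by (auto simp: unitary_mat_def mat_adjoint_carrier)
  note assoc = assoc_mult_mat[of _ n n _ n _ n]
  note closed = mult_carrier_mat[of _ n n _ n]
  have "mat_adjoint V * mat_adjoint U * (U * V) = mat_adjoint V * ((mat_adjoint U * U) * V)"
    using c by (simp add: assoc closed)
  moreover have "U * V * (mat_adjoint V * mat_adjoint U) = U * ((V * mat_adjoint V) * mat_adjoint U)"
    using c by (simp add: assoc closed)
  ultimately show ?thesis
    using c u by (simp add: unitary_mat_def mat_adjoint_mult[of U n n V n] closed)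
qed

lemma unitary_conj_diag_carrier:
  "unitary_mat n U \<Longrightarrow> unitary_conj_diag n U d \<in> carrier_mat n n"
  by (auto simp: unitary_mat_def unitary_conj_diag_def mat_adjoint_carrier
      intro!: mult_carrier_mat[of _ n n _ n])

lemma unitary_conj_diag_one:
  assumes "unitary_mat n U"
  shows "unitary_conj_diag n U (\<lambda>_. 1) = 1\<^sub>m n"
  using assms right_mult_one_mat[of U n n] by (simp add: unitary_conj_diag_def unitary_mat_def)

lemma trace_unitary_conj_diag:
  assumes U: "unitary_mat n U"
  shows "mat_trace (unitary_conj_diag n U d) = complex_of_real (\<Sum>j<n. d j)"
proof -
  have c: "U \<in> carrier_mat n n" using U by (simp add: unitary_mat_def)
  have "(unitary_conj_diag n U d) $$ (i, i)
      = (\<Sum>j<n. complex_of_real (d j) * (U $$ (i, j) * cnj (U $$ (i, j))))" if "i < n" for i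
    unfolding unitary_conj_diag_def using c that
    by (auto simp: mat_diag_mult_right[of _ n n] scalar_prod_def lessThan_atLeast0 intro!: sum.cong)
  then have "mat_trace (unitary_conj_diag n U d)
      = (\<Sum>i<n. \<Sum>j<n. complex_of_real (d j) * (U $$ (i, j) * cnj (U $$ (i, j))))"
    using unitary_conj_diag_carrier[OF U, of d] by (simp add: mat_trace_def)
  also have "\<dots> = (\<Sum>j<n. \<Sum>i<n. complex_of_real (d j) * (U $$ (i, j) * cnj (U $$ (i, j))))"
    by (rule sum.swap)
  also have "\<dots> = (\<Sum>j<n. complex_of_real (d j) * (col U j \<bullet>c col U j))"
    using c by (auto simp: sum_distrib_left scalar_prod_def lessThan_atLeast0 intro!: sum.cong)
  also have "\<dots> = complex_of_real (\<Sum>j<n. d j)"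
    using unitary_mat_orthonormal_cols[OF U] by simp
  finally show ?thesis .
qed

section \<open>The spectral theorem\<close>

text \<open>An eigenvector exists because the characteristic polynomial has a complex root; completing it
  to a basis and orthonormalizing keeps its direction.\<close>
lemma unitary_mat_first_col_eigenvector:
  fixes A :: "complex mat"
  assumes A: "A \<in> carrier_mat n n" and n: "n > 0"
  obtains U e where "unitary_mat n U" "A *\<^sub>v col U 0 = e \<cdot>\<^sub>v col U 0"
proof -
  obtain e where "eigenvalue A e"
    using spectrum_non_empty[OF A n] by (auto simp: spectrum_def)
  then obtain v where "eigenvector A v e" by (auto simp: eigenvalue_def)
  then have v: "v \<in> carrier_vec n" "v \<noteq> 0\<^sub>v n" and ev: "A *\<^sub>v v = e \<cdot>\<^sub>v v"
    using A by (auto simp: eigenvector_def)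
  interpret cof_vec_space n "TYPE(complex)" .
  define b where "b = basis_completion v"
  define ws where "ws = gram_schmidt n b"
  from basis_completion[OF v, folded b_def]
  have dist_b: "distinct b" and indep: "\<not> lin_dep (set b)" and b: "set b \<subseteq> carrier_vec n"
    and hdb: "hd b = v" and len_b: "length b = n" by auto
  from hdb len_b n obtain vs where bv: "b = v # vs" by (cases b) auto
  from gram_schmidt_result[OF b dist_b indep refl, folded ws_def]
  have ws: "set ws \<subseteq> carrier_vec n" "corthogonal ws" "length ws = n"
    by (auto simp: len_b)
  from gram_schmidt_hd[OF v(1), of vs, folded bv] have "hd ws = v" unfolding ws_def .
  then have ws0: "ws ! 0 = v" using ws(3) n by (cases ws) auto
  have wsc: "ws ! i \<in> carrier_vec n" if "i < n" for i
    using ws that by (auto simp: subset_eq)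
  \<comment> \<open>Gram-Schmidt only gives an orthogonal basis, so each vector is rescaled to length one.\<close>
  define g where "g i = complex_of_real (1 / sqrt (Re (ws ! i \<bullet>c ws ! i)))" for i
  have g: "g i * cnj (g i) * (ws ! i \<bullet>c ws ! i) = 1" if "i < n" for i
  proof -
    have "ws ! i \<bullet>c ws ! i \<noteq> 0" using corthogonalD[OF ws(2)] that ws(3) by auto
    moreover have "0 \<le> ws ! i \<bullet>c ws ! i" by (rule conjugate_square_ge_0_vec)
    ultimately obtain t where t: "ws ! i \<bullet>c ws ! i = complex_of_real t" "t > 0"
      by (metis complex_eq_iff less_eq_complex_def complex_of_real_def Re_complex_of_real
          Im_complex_of_real zero_complex.sel order_le_less)
    have "1 / sqrt t * (1 / sqrt t) * t = 1" using t(2) by simp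
    then show ?thesis unfolding g_def t(1)
      by (metis Re_complex_of_real complex_cnj_complex_of_real of_real_1 of_real_mult)
  qed
  define U where "U = mat n n (\<lambda>(i, j). g j * (ws ! j) $ i)"
  have U: "U \<in> carrier_mat n n" by (simp add: U_def)
  have col: "col U j = g j \<cdot>\<^sub>v ws ! j" if "j < n" for j
    using that wsc[OF that] by (intro eq_vecI) (auto simp: U_def)
  have "unitary_mat n U"
  proof (rule unitary_matI_cols[OF U])
    fix i j assume ij: "i < n" "j < n"
    have "col U i \<bullet>c col U j = g i * cnj (g j) * (ws ! i \<bullet>c ws ! j)"
      using wsc[OF ij(1)] wsc[OF ij(2)] ij
      by (simp add: col conjugate_smult_vec smult_scalar_prod_distrib[of _ n]
          scalar_prod_smult_distrib[of _ n])
    then show "col U i \<bullet>c col U j = (if i = j then 1 else 0)"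
      using g corthogonalD[OF ws(2), of i j] ij ws(3) by auto
  qed
  moreover have "A *\<^sub>v col U 0 = e \<cdot>\<^sub>v col U 0"
    using n A v ev by (simp add: col ws0 mult_mat_vec smult_smult_assoc mult.commute)
  ultimately show ?thesis using that by blast
qed

text \<open>Deflation: in an orthonormal basis that starts with an eigenvector, a Hermitian matrix splits
  off a one-by-one block, and induction on the size diagonalizes the remaining block.\<close>
theorem hermitian_unitarily_diagonalizable:
  assumes "A \<in> carrier_mat n n" "mat_adjoint A = A"
  shows "\<exists>U d. unitary_mat n U \<and> A = unitary_conj_diag n U d"
  using assms
proof (induction n arbitrary: A)
  case 0
  have "unitary_mat 0 (1\<^sub>m 0)"
    by (rule unitary_matI_cols) auto
  moreover have "A = unitary_conj_diag 0 (1\<^sub>m 0) d" for d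
    using 0 unitary_conj_diag_carrier[OF calculation, of d] by (intro eq_matI) auto
  ultimately show ?case by blast
next
  case (Suc n)
  let ?N = "Suc n"
  note A = Suc.prems(1)
  obtain W e where W: "unitary_mat ?N W" and ev: "A *\<^sub>v col W 0 = e \<cdot>\<^sub>v col W 0"
    using unitary_mat_first_col_eigenvector[OF A] by blast
  have c: "W \<in> carrier_mat ?N ?N" "mat_adjoint W \<in> carrier_mat ?N ?N"
    and u: "mat_adjoint W * W = 1\<^sub>m ?N" "W * mat_adjoint W = 1\<^sub>m ?N"
    using W by (auto simp: unitary_mat_def mat_adjoint_carrier)
  note assoc = assoc_mult_mat[of _ ?N ?N _ ?N _ ?N]
  note closed = mult_carrier_mat[of _ ?N ?N _ ?N]
  define M where "M = mat_adjoint W * A * W"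
  have M: "M \<in> carrier_mat ?N ?N" using A c by (simp add: M_def closed)
  have herm: "mat_adjoint M = M"
    using A c Suc.prems(2)
    by (simp add: M_def mat_adjoint_mult[of _ ?N ?N _ ?N] assoc closed)
  have M_sym: "M $$ (i, j) = cnj (M $$ (j, i))" if "i < ?N" "j < ?N" for i j
    using mat_adjoint_index[of i M j] that M by (simp add: herm)
  have A_eq: "A = W * M * mat_adjoint W"
  proof -
    have "W * M * mat_adjoint W = (W * mat_adjoint W) * A * (W * mat_adjoint W)"
      using A c by (simp add: M_def assoc closed)
    then show ?thesis using A u by simp
  qed
  \<comment> \<open>Since \<open>W\<^sup>* A w\<^sub>0 = e W\<^sup>* w\<^sub>0\<close>, the first column of \<open>M\<close> is \<open>e\<close> times the first unit vector;
    being Hermitian, \<open>M\<close> is then block diagonal, and the eigenvalue \<open>e\<close> is real.\<close>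
  have col0: "M $$ (i, 0) = (if i = 0 then e else 0)" if i: "i < ?N" for i
  proof -
    have "col M 0 = mat_adjoint W *\<^sub>v (A *\<^sub>v col W 0)"
      unfolding M_def using A c col_carrier_vec[of 0 ?N W ?N]
      by (subst col_mult2[of _ ?N ?N _ ?N]) (auto simp: closed assoc_mult_mat_vec[of _ ?N ?N _ ?N])
    also have "\<dots> = e \<cdot>\<^sub>v (mat_adjoint W *\<^sub>v col W 0)"
      using c mult_mat_vec[of "mat_adjoint W" ?N ?N "col W 0" e] col_carrier_vec[of 0 ?N W ?N]
      by (simp add: ev)
    also have "mat_adjoint W *\<^sub>v col W 0 = col (mat_adjoint W * W) 0"
      by (rule col_mult2[symmetric]) (use c in auto)
    finally have "col M 0 = e \<cdot>\<^sub>v col (1\<^sub>m ?N) 0" by (simp add: u)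
    from arg_cong[OF this, of "\<lambda>v. v $ i"] show ?thesis using i M by auto
  qed
  have row0: "M $$ (0, i) = (if i = 0 then e else 0)" if i: "i < ?N" for i
    using M_sym[of 0 i] col0[OF i] i col0[of 0] M_sym[of 0 0] by auto
  have e_real: "e = complex_of_real (Re e)"
    using M_sym[of 0 0] col0[of 0] by (simp add: complex_eq_iff)
  define A3 where "A3 = mat n n (\<lambda>(i, j). M $$ (Suc i, Suc j))"
  have A3: "A3 \<in> carrier_mat n n" by (simp add: A3_def)
  have "mat_adjoint A3 = A3"
    by (rule eq_matI) (auto simp: A3_def M_sym[symmetric])
  from Suc.IH[OF A3 this] obtain U3 d3 where U3: "unitary_mat n U3"
    and A3_eq: "A3 = unitary_conj_diag n U3 d3" by blast
  have c3: "U3 \<in> carrier_mat n n" "mat_adjoint U3 \<in> carrier_mat n n"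
    and u3: "mat_adjoint U3 * U3 = 1\<^sub>m n" "U3 * mat_adjoint U3 = 1\<^sub>m n"
    using U3 by (auto simp: unitary_mat_def mat_adjoint_carrier)
  define blk where "blk a X = four_block_mat (mat 1 1 (\<lambda>_. a)) (0\<^sub>m 1 n) (0\<^sub>m n 1) X"
    for a :: complex and X :: "complex mat"
  have blk_carrier: "blk a X \<in> carrier_mat ?N ?N" if "X \<in> carrier_mat n n" for a X
    using four_block_carrier_mat[of "mat 1 1 (\<lambda>_. a)" 1 1 X n n "0\<^sub>m 1 n" "0\<^sub>m n 1"] that
    by (simp add: blk_def)
  have blk_mult: "blk a X * blk b Y = blk (a * b) (X * Y)"
    if X: "X \<in> carrier_mat n n" and Y: "Y \<in> carrier_mat n n" for a b X Y
  proof -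
    have "mat 1 1 (\<lambda>_. a) * mat 1 1 (\<lambda>_. b) = mat 1 1 (\<lambda>_. a * b)"
      by (rule eq_matI) (auto simp: scalar_prod_def)
    moreover have "X * Y \<in> carrier_mat n n" using X Y by (rule mult_carrier_mat)
    ultimately show ?thesis
      unfolding blk_def using X Y
      by (subst mult_four_block_mat[of _ 1 1 _ n _ n _ _ 1 _ n]) auto
  qed
  have blk_adj: "mat_adjoint (blk a X) = blk (cnj a) (mat_adjoint X)"
    if "X \<in> carrier_mat n n" for a X
    using that by (intro eq_matI) (auto simp: blk_def)
  have blk_one: "blk 1 (1\<^sub>m n) = 1\<^sub>m ?N"
    by (rule eq_matI) (auto simp: blk_def)
  have blk_diag: "blk (complex_of_real a) (mat_diag n (\<lambda>i. complex_of_real (d i)))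
      = mat_diag ?N (\<lambda>i. complex_of_real (case_nat a d i))" for a d
    by (rule eq_matI) (auto simp: blk_def mat_diag_def split: nat.split)
  have M_blk: "M = blk e A3"
    using M by (intro eq_matI) (auto simp: blk_def A3_def col0 row0)
  define P where "P = blk 1 U3"
  have P: "unitary_mat ?N P"
    using c3 u3 by (simp add: unitary_mat_def P_def blk_carrier blk_adj blk_mult blk_one)
  have Pc: "P \<in> carrier_mat ?N ?N" "mat_adjoint P \<in> carrier_mat ?N ?N"
    using P by (auto simp: unitary_mat_def mat_adjoint_carrier)
  define D where "D = mat_diag ?N (\<lambda>i. complex_of_real (case_nat (Re e) d3 i))"
  have D: "D \<in> carrier_mat ?N ?N" by (simp add: D_def)
  have "M = P * D * mat_adjoint P"
    unfolding M_blk A3_eq unitary_conj_diag_def P_def D_def blk_diag[symmetric]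
    using c3 e_real by (simp add: blk_adj blk_mult mult_carrier_mat[of _ n n _ n])
  then have "A = W * P * D * mat_adjoint (W * P)"
    unfolding A_eq using c Pc D by (simp add: mat_adjoint_mult[of _ ?N ?N _ ?N] assoc closed)
  then show ?case
    using unitary_mat_mult[OF W P] unfolding unitary_conj_diag_def D_def by blast
qed

section \<open>Quadratic forms and the positive semidefinite cone\<close>

definition quad_form :: "complex mat \<Rightarrow> complex vec \<Rightarrow> real" where
  "quad_form Z v = Re ((Z *\<^sub>v v) \<bullet>c v)"

lemma quad_form_add:
  assumes "A \<in> carrier_mat n n" "B \<in> carrier_mat n n" "v \<in> carrier_vec n"
  shows "quad_form (A + B) v = quad_form A v + quad_form B v"
  using assms by (simp add: quad_form_def add_mult_distrib_mat_vec[of _ n n]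
      add_scalar_prod_distrib[of _ n])

lemma quad_form_smult:
  assumes "A \<in> carrier_mat n n" "v \<in> carrier_vec n"
  shows "quad_form (complex_of_real c \<cdot>\<^sub>m A) v = c * quad_form A v"
proof -
  have "(complex_of_real c \<cdot>\<^sub>m A) *\<^sub>v v = complex_of_real c \<cdot>\<^sub>v (A *\<^sub>v v)"
    using assms by (intro eq_vecI) auto
  then show ?thesis
    using assms by (simp add: quad_form_def smult_scalar_prod_distrib[of _ n])
qed

text \<open>In the coordinates given by an eigenbasis, the quadratic form is a weighted sum of squares.
  This reduces everything below to real sums over the overlaps \<open>\<bar>\<langle>v, u\<^sub>j\<rangle>\<bar>\<^sup>2\<close>.\<close>
lemma quad_form_unitary_conj_diag:
  assumes U: "unitary_mat n U" and v: "v \<in> carrier_vec n"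
  shows "quad_form (unitary_conj_diag n U d) v = (\<Sum>j<n. d j * (cmod (v \<bullet>c col U j))\<^sup>2)"
proof -
  define z where "z = mat_adjoint U *\<^sub>v v"
  define D where "D = mat_diag n (\<lambda>i. complex_of_real (d i))"
  have c: "U \<in> carrier_mat n n" "mat_adjoint U \<in> carrier_mat n n" "D \<in> carrier_mat n n"
    using U by (auto simp: unitary_mat_def mat_adjoint_carrier D_def)
  have z: "z \<in> carrier_vec n" using c v by (simp add: z_def)
  have zj: "z $ j = v \<bullet>c col U j" if "j < n" for j
    using that c v by (simp add: z_def mat_adjoint_mult_vec_index[of _ n n] del: index_mult_mat_vec)
  have Dz: "D *\<^sub>v z = vec n (\<lambda>i. complex_of_real (d i) * z $ i)"
  proof (rule eq_vecI)
    fix i assume "i < dim_vec (vec n (\<lambda>i. complex_of_real (d i) * z $ i))"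
    then have "i < n" by simp
    then show "(D *\<^sub>v z) $ i = vec n (\<lambda>i. complex_of_real (d i) * z $ i) $ i"
      using z by (simp add: D_def mat_diag_def scalar_prod_def if_distrib[of "\<lambda>x. x * _"] cong: if_cong)
  qed (use c in auto)
  have "unitary_conj_diag n U d *\<^sub>v v = U *\<^sub>v (D *\<^sub>v z)"
    using c v by (simp add: unitary_conj_diag_def D_def[symmetric] z_def
        assoc_mult_mat_vec[of _ n n _ n] mult_carrier_mat[of _ n n _ n])
  then have "(unitary_conj_diag n U d *\<^sub>v v) \<bullet>c v = (D *\<^sub>v z) \<bullet>c z"
    using c v z by (simp add: mat_adjoint_cscalar[of _ n n] z_def)
  also have "\<dots> = (\<Sum>j<n. complex_of_real (d j * (cmod (z $ j))\<^sup>2))"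
    unfolding Dz using z
    by (auto simp: scalar_prod_def lessThan_atLeast0 complex_mult_cnj_cmod mult.assoc intro!: sum.cong)
  finally show ?thesis
    by (simp add: quad_form_def zj flip: of_real_sum)
qed

text \<open>The quadratic form of the identity matrix, which every unitary basis diagonalizes.\<close>
lemma unitary_mat_Parseval:
  assumes U: "unitary_mat n U" and v: "v \<in> carrier_vec n"
  shows "(\<Sum>j<n. (cmod (v \<bullet>c col U j))\<^sup>2) = Re (v \<bullet>c v)"
  using quad_form_unitary_conj_diag[OF U v, of "\<lambda>_. 1"] v
  by (simp add: unitary_conj_diag_one[OF U] quad_form_def)

lemma quad_form_eigenvector:
  assumes U: "unitary_mat n U" and i: "i < n"
  shows "quad_form (unitary_conj_diag n U d) (col U i) = d i"
proof -
  have "quad_form (unitary_conj_diag n U d) (col U i) = (\<Sum>j<n. if j = i then d j else 0)"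
    unfolding quad_form_unitary_conj_diag[OF U unitary_col_carrier[OF U]]
    using i by (intro sum.cong) (auto simp: unitary_mat_orthonormal_cols[OF U])
  also have "\<dots> = d i" using i by simp
  finally show ?thesis .
qed

lemma psd_carrier: "A \<in> psd_cone n \<Longrightarrow> A \<in> carrier_mat n n"
  by (simp add: psd_cone_def)

lemma quad_form_nonneg:
  "A \<in> psd_cone n \<Longrightarrow> v \<in> carrier_vec n \<Longrightarrow> 0 \<le> quad_form A v"
  by (auto simp: psd_cone_def quad_form_def less_eq_complex_def)

lemma psd_diagonalization:
  assumes "A \<in> psd_cone n"
  obtains U d where "unitary_mat n U" "A = unitary_conj_diag n U d" "\<And>i. i < n \<Longrightarrow> 0 \<le> d i"
proof -
  obtain U d where U: "unitary_mat n U" and A: "A = unitary_conj_diag n U d"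
    using hermitian_unitarily_diagonalizable[of A n] assms by (auto simp: psd_cone_def)
  have "0 \<le> d i" if "i < n" for i
    using quad_form_nonneg[OF assms unitary_col_carrier[OF U], of i]
      quad_form_eigenvector[OF U that, of d] by (simp add: A)
  then show ?thesis using that U A by blast
qed

lemma psd_cone_combine:
  assumes A: "A \<in> psd_cone n" and B: "B \<in> psd_cone n" and "0 \<le> a" "0 \<le> b"
  shows "complex_of_real a \<cdot>\<^sub>m A + complex_of_real b \<cdot>\<^sub>m B \<in> psd_cone n"
    (is "?C \<in> _")
proof -
  have Ac: "A \<in> carrier_mat n n" "mat_adjoint A = A" and Bc: "B \<in> carrier_mat n n" "mat_adjoint B = B"
    using A B by (auto simp: psd_cone_def)
  have sym: "X $$ (i, j) = cnj (X $$ (j, i))"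
    if "X \<in> carrier_mat n n" "mat_adjoint X = X" "i < n" "j < n" for X i j
    using mat_adjoint_index[of i X j] that by auto
  have herm: "mat_adjoint ?C = ?C"
  proof (rule eq_matI)
    fix i j assume "i < dim_row ?C" "j < dim_col ?C"
    then have "i < n" "j < n" using Bc by auto
    then show "mat_adjoint ?C $$ (i, j) = ?C $$ (i, j)"
      using Ac Bc sym[OF Ac, of i j] sym[OF Bc, of i j] by auto
  qed (use Bc in auto)
  have "0 \<le> (?C *\<^sub>v v) \<bullet>c v" if v: "v \<in> carrier_vec n" for v
  proof -
    have sm: "(complex_of_real t \<cdot>\<^sub>m X) *\<^sub>v v = complex_of_real t \<cdot>\<^sub>v (X *\<^sub>v v)"
      if "X \<in> carrier_mat n n" for t X
      using that v by (intro eq_vecI) auto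
    have "(?C *\<^sub>v v) \<bullet>c v
        = complex_of_real a * ((A *\<^sub>v v) \<bullet>c v) + complex_of_real b * ((B *\<^sub>v v) \<bullet>c v)"
      using Ac Bc v by (simp add: add_mult_distrib_mat_vec[of _ n n] sm
          add_scalar_prod_distrib[of _ n] smult_scalar_prod_distrib[of _ n])
    moreover have "0 \<le> (A *\<^sub>v v) \<bullet>c v" "0 \<le> (B *\<^sub>v v) \<bullet>c v"
      using A B v by (auto simp: psd_cone_def)
    ultimately show ?thesis using assms(3,4)
      by (auto simp: less_eq_complex_def)
  qed
  then show ?thesis using Ac Bc herm by (auto simp: psd_cone_def)
qed

lemma psd_cone_add:
  assumes A: "A \<in> psd_cone n" and B: "B \<in> psd_cone n"
  shows "A + B \<in> psd_cone n"
proof -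
  have one: "(1 :: complex) \<cdot>\<^sub>m X = X" for X
    by (rule eq_matI) auto
  show ?thesis
    using psd_cone_combine[OF A B, of 1 1] by (simp add: one)
qed

section \<open>Convexity inequalities for real powers\<close>

text \<open>The endpoint \<open>0\<close> has to be included because semidefinite matrices may be singular; there
  the inequality reduces to \<open>t\<^sup>p \<le> t\<close> for \<open>0 < t < 1\<close>.\<close>
lemma powr_convex_nonneg:
  fixes p :: real
  assumes "1 \<le> p"
  shows "convex_on {0..} (\<lambda>x. x powr p)"
proof (rule convex_on_linorderI)
  fix t x y :: real
  assume t: "0 < t" "t < 1" and xy: "x \<in> {0..}" "y \<in> {0..}" "x < y"
  show "((1 - t) *\<^sub>R x + t *\<^sub>R y) powr p \<le> (1 - t) * x powr p + t * y powr p"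
  proof (cases "x = 0")
    case True
    have "t powr p \<le> t powr 1" using t assms by (intro powr_mono') auto
    then show ?thesis using True t xy by (simp add: powr_mult mult_right_mono)
  next
    case False
    then show ?thesis
      using convex_onD[OF powr_convex[OF assms], of t x y] t xy by auto
  qed
qed simp

lemma powr_concave_nonneg:
  fixes p :: real
  assumes "0 < p" "p \<le> 1"
  shows "concave_on {0..} (\<lambda>x. x powr p)"
  unfolding concave_on_def
proof (rule convex_on_linorderI)
  fix t x y :: real
  assume t: "0 < t" "t < 1" and xy: "x \<in> {0..}" "y \<in> {0..}" "x < y"
  show "- (((1 - t) *\<^sub>R x + t *\<^sub>R y) powr p) \<le> (1 - t) * - (x powr p) + t * - (y powr p)"
  proof (cases "x = 0")
    case True
    have "t powr 1 \<le> t powr p" using t assms by (intro powr_mono') auto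
    then show ?thesis using True t xy by (simp add: powr_mult mult_right_mono)
  next
    case False
    \<comment> \<open>The derivative may blow up at \<open>0\<close>, so the derivative test is used only on the open
      half-line.\<close>
    have "convex_on {0<..} (\<lambda>x. - (x powr p))"
    proof (rule convex_on_realI)
      fix x :: real assume "x \<in> {0<..}"
      then show "((\<lambda>x. - (x powr p)) has_real_derivative - (p * x powr (p - 1))) (at x)"
        by (auto intro!: derivative_eq_intros)
    next
      fix x y :: real assume "x \<in> {0<..}" "y \<in> {0<..}" "x \<le> y"
      then show "- (p * x powr (p - 1)) \<le> - (p * y powr (p - 1))"
        using assms by (auto intro!: mult_left_mono powr_mono2')
    qed auto
    from convex_onD[OF this, of t x y] show ?thesis using False t xy by auto
  qed
qed simp

lemma powr_subadditive:
  fixes a b t :: real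
  assumes "0 \<le> a" "0 \<le> b" "0 \<le> t" "t \<le> 1"
  shows "(a + b) powr t \<le> a powr t + b powr t"
proof (cases "a + b = 0")
  case False
  define s where "s = a + b"
  have s: "s > 0" using False assms by (simp add: s_def)
  \<comment> \<open>On \<open>[0, 1]\<close> the power \<open>u\<^sup>t\<close> dominates \<open>u\<close>; this is applied to the shares of \<open>a\<close>
    and \<open>b\<close> in their sum.\<close>
  have le: "c / s * s powr t \<le> c powr t" if "0 \<le> c" "c \<le> s" for c
  proof -
    have "(c / s) powr 1 \<le> (c / s) powr t"
      using that s assms by (intro powr_mono') auto
    then have "c / s \<le> c powr t / s powr t"
      using that s by (simp add: powr_divide)
    then show ?thesis using s by (simp add: pos_le_divide_eq)
  qed
  have "s powr t = a / s * s powr t + b / s * s powr t"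
    using s by (simp add: s_def add_divide_distrib[symmetric] distrib_right[symmetric])
  also have "\<dots> \<le> a powr t + b powr t"
    using le[of a] le[of b] assms by (intro add_mono) (auto simp: s_def)
  finally show ?thesis by (simp add: s_def)
qed simp

lemma sum_powr_Minkowski:
  fixes c d :: "'i \<Rightarrow> real"
  assumes I: "finite I" and c: "\<And>i. i \<in> I \<Longrightarrow> 0 \<le> c i" and d: "\<And>i. i \<in> I \<Longrightarrow> 0 \<le> d i"
    and r: "1 \<le> r"
  shows "(\<Sum>i\<in>I. (c i + d i) powr r) powr (1 / r)
    \<le> (\<Sum>i\<in>I. c i powr r) powr (1 / r) + (\<Sum>i\<in>I. d i powr r) powr (1 / r)"
proof -
  define \<alpha> where "\<alpha> = (\<Sum>i\<in>I. c i powr r) powr (1 / r)"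
  define \<beta> where "\<beta> = (\<Sum>i\<in>I. d i powr r) powr (1 / r)"
  have zero: "\<forall>i\<in>I. f i = 0" if "(\<Sum>i\<in>I. f i powr r) powr (1 / r) = 0" for f :: "'i \<Rightarrow> real"
  proof -
    have "(\<Sum>i\<in>I. f i powr r) = 0" using that by simp
    then show ?thesis using I by (simp add: sum_nonneg_eq_0_iff)
  qed
  consider "\<alpha> = 0" | "\<beta> = 0" | "\<alpha> > 0" "\<beta> > 0"
    by (metis \<alpha>_def \<beta>_def powr_ge_zero order_le_less)
  then show ?thesis
  proof cases
    case 1
    then have "\<forall>i\<in>I. c i = 0" using zero unfolding \<alpha>_def by blast
    then show ?thesis by simp
  next
    case 2
    then have "\<forall>i\<in>I. d i = 0" using zero unfolding \<beta>_def by blast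
    then show ?thesis by simp
  next
    case 3
    have \<alpha>r: "\<alpha> powr r = (\<Sum>i\<in>I. c i powr r)" and \<beta>r: "\<beta> powr r = (\<Sum>i\<in>I. d i powr r)"
      using r by (auto simp: \<alpha>_def \<beta>_def powr_powr sum_nonneg)
    define t where "t = \<beta> / (\<alpha> + \<beta>)"
    have t: "0 \<le> t" "t \<le> 1" "1 - t = \<alpha> / (\<alpha> + \<beta>)"
      using 3 by (auto simp: t_def field_simps)
    \<comment> \<open>After normalizing both families, the sum becomes a convex combination whose weights
      are the shares of \<open>\<alpha>\<close> and \<open>\<beta>\<close> in \<open>\<alpha> + \<beta>\<close>.\<close>
    have convex: "((c i + d i) / (\<alpha> + \<beta>)) powr r
        \<le> (1 - t) * (c i powr r / \<alpha> powr r) + t * (d i powr r / \<beta> powr r)" if i: "i \<in> I" for i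
    proof -
      have "(c i + d i) / (\<alpha> + \<beta>) = (1 - t) *\<^sub>R (c i / \<alpha>) + t *\<^sub>R (d i / \<beta>)"
        using 3 unfolding t(3) by (simp add: t_def add_divide_distrib)
      also have "\<dots> powr r \<le> (1 - t) * (c i / \<alpha>) powr r + t * (d i / \<beta>) powr r"
        using 3 c[OF i] d[OF i] t by (intro convex_onD[OF powr_convex_nonneg[OF r]]) auto
      finally show ?thesis using 3 c[OF i] d[OF i] by (simp add: powr_divide)
    qed
    have "(\<Sum>i\<in>I. (c i + d i) powr r) / (\<alpha> + \<beta>) powr r = (\<Sum>i\<in>I. ((c i + d i) / (\<alpha> + \<beta>)) powr r)"
      using 3 c d by (simp add: sum_divide_distrib powr_divide)
    also have "\<dots> \<le> (\<Sum>i\<in>I. (1 - t) * (c i powr r / \<alpha> powr r) + t * (d i powr r / \<beta> powr r))"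
      by (intro sum_mono convex)
    also have "\<dots> = (1 - t) * ((\<Sum>i\<in>I. c i powr r) / \<alpha> powr r) + t * ((\<Sum>i\<in>I. d i powr r) / \<beta> powr r)"
      by (simp add: sum.distrib sum_distrib_left sum_divide_distrib)
    also have "\<dots> = 1" unfolding \<alpha>r[symmetric] \<beta>r[symmetric] using 3 by simp
    finally have "(\<Sum>i\<in>I. (c i + d i) powr r) \<le> (\<alpha> + \<beta>) powr r"
      using 3 by (simp add: divide_le_eq)
    then have "(\<Sum>i\<in>I. (c i + d i) powr r) powr (1 / r) \<le> ((\<alpha> + \<beta>) powr r) powr (1 / r)"
      using r by (intro powr_mono2) (auto intro: sum_nonneg)
    also have "\<dots> = \<alpha> + \<beta>" using 3 r by (simp add: powr_powr)
    finally show ?thesis by (simp add: \<alpha>_def \<beta>_def)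
  qed
qed

text \<open>The missing mass \<open>1 - \<Sum>m\<close> may be thought of as sitting at \<open>0\<close>, where the convex power
  function vanishes.\<close>
lemma powr_substochastic_Jensen:
  fixes m s :: "'i \<Rightarrow> real"
  assumes I: "finite I" and m: "\<And>k. k \<in> I \<Longrightarrow> 0 \<le> m k" "sum m I \<le> 1"
    and s: "\<And>k. k \<in> I \<Longrightarrow> 0 \<le> s k" and r: "1 \<le> r"
  shows "(\<Sum>k\<in>I. m k * s k) powr r \<le> (\<Sum>k\<in>I. m k * s k powr r)"
proof (cases "sum m I = 0")
  case True
  then have "\<forall>k\<in>I. m k = 0" using I m by (simp add: sum_nonneg_eq_0_iff)
  then show ?thesis by simp
next
  case False
  define M where "M = sum m I"
  have "0 \<le> M" unfolding M_def using m(1) by (rule sum_nonneg)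
  then have M: "0 < M" "M \<le> 1" using False m(2) by (auto simp: M_def)
  have "(\<Sum>k\<in>I. (m k / M) *\<^sub>R s k) powr r \<le> (\<Sum>k\<in>I. m k / M * s k powr r)"
    using I M m s False
    by (intro convex_on_sum[OF _ _ powr_convex_nonneg[OF r]])
      (auto simp: M_def sum_divide_distrib[symmetric])
  then have J: "((\<Sum>k\<in>I. m k * s k) / M) powr r \<le> (\<Sum>k\<in>I. m k * s k powr r) / M"
    by (simp add: sum_divide_distrib)
  have nn: "0 \<le> (\<Sum>k\<in>I. m k * s k)" "0 \<le> (\<Sum>k\<in>I. m k * s k powr r)"
    using m s by (auto intro!: sum_nonneg)
  have "M powr r \<le> M powr 1" using M r by (intro powr_mono') auto
  then have Mr: "M powr r \<le> M" using M by simp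
  have "(\<Sum>k\<in>I. m k * s k) powr r = M powr r * ((\<Sum>k\<in>I. m k * s k) / M) powr r"
    using M nn by (simp add: powr_divide)
  also have "\<dots> \<le> M * ((\<Sum>k\<in>I. m k * s k powr r) / M)"
    using J Mr M by (intro mult_mono) auto
  finally show ?thesis using M by simp
qed

section \<open>Peierls' inequality and its consequences for traces\<close>

text \<open>The values of the quadratic form on one orthonormal basis arise from the eigenvalues through
  the matrix of squared overlaps of two orthonormal bases. By Parseval this matrix is doubly
  stochastic: Jensen applies in each row because the rows sum to one, and the column sums
  recover the sum over the eigenvalues.\<close>
lemma Peierls_inequality:
  assumes U: "unitary_mat n U" and V: "unitary_mat n V"
    and a: "\<And>j. j < n \<Longrightarrow> a j \<in> S" and \<phi>: "convex_on S \<phi>"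
  shows "(\<Sum>i<n. \<phi> (quad_form (unitary_conj_diag n V a) (col U i))) \<le> (\<Sum>j<n. \<phi> (a j))"
proof -
  define m where "m i j = (cmod (col U i \<bullet>c col V j))\<^sup>2" for i j
  have m_sym: "m i j = (cmod (col V j \<bullet>c col U i))\<^sup>2" for i j
    using cmod_cscalar_commute[OF unitary_col_carrier[OF U, of i] unitary_col_carrier[OF V, of j]]
    by (simp add: m_def)
  have rows: "(\<Sum>j<n. m i j) = 1" if "i < n" for i
    unfolding m_def unitary_mat_Parseval[OF V unitary_col_carrier[OF U]]
    using unitary_mat_orthonormal_cols[OF U that that] by simp
  have cols: "(\<Sum>i<n. m i j) = 1" if "j < n" for j
    unfolding m_sym unitary_mat_Parseval[OF U unitary_col_carrier[OF V]]
    using unitary_mat_orthonormal_cols[OF V that that] by simp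
  have "(\<Sum>i<n. \<phi> (quad_form (unitary_conj_diag n V a) (col U i)))
      = (\<Sum>i<n. \<phi> (\<Sum>j<n. m i j *\<^sub>R a j))"
    by (simp add: quad_form_unitary_conj_diag[OF V unitary_col_carrier[OF U]] m_def mult.commute)
  also have "\<dots> \<le> (\<Sum>i<n. \<Sum>j<n. m i j * \<phi> (a j))"
    using a rows by (intro sum_mono convex_on_sum[OF _ _ \<phi>]) (auto simp: m_def)
  also have "\<dots> = (\<Sum>j<n. \<Sum>i<n. m i j * \<phi> (a j))"
    by (rule sum.swap)
  also have "\<dots> = (\<Sum>j<n. \<phi> (a j))"
    by (simp add: sum_distrib_right[symmetric] cols)
  finally show ?thesis .
qed

abbreviation trace_power :: "complex mat \<Rightarrow> real \<Rightarrow> real" where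
  "trace_power Z r \<equiv> Re (mat_trace (psd_power Z r))"

lemma trace_power_unitary_conj_diag:
  assumes "unitary_mat n U"
  shows "trace_power (unitary_conj_diag n U d) r = (\<Sum>i<n. if r = 0 then 1 else d i powr r)"
proof -
  have "psd_power (unitary_conj_diag n U d) r
      = unitary_conj_diag n U (\<lambda>i. if r = 0 then 1 else d i powr r)"
    unfolding psd_power_def hermitian_fun_eq[OF assms] o_def ..
  then show ?thesis
    by (simp only: trace_unitary_conj_diag[OF assms] Re_complex_of_real)
qed

lemma trace_power_nonneg: "A \<in> psd_cone n \<Longrightarrow> 0 \<le> trace_power A r"
  by (erule psd_diagonalization) (simp add: trace_power_unitary_conj_diag sum_nonneg)

lemma sum_quad_form_powr_le:
  assumes A: "A \<in> psd_cone n" and U: "unitary_mat n U" and r: "1 \<le> r"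
  shows "(\<Sum>i<n. quad_form A (col U i) powr r) \<le> trace_power A r"
proof -
  obtain V a where V: "unitary_mat n V" "A = unitary_conj_diag n V a" "\<And>i. i < n \<Longrightarrow> 0 \<le> a i"
    using psd_diagonalization[OF A] by blast
  then show ?thesis
    using Peierls_inequality[OF U V(1) _ powr_convex_nonneg[OF r], of a] r
    by (simp add: trace_power_unitary_conj_diag)
qed

text \<open>The reversed form of Peierls' inequality, applied to the convex function \<open>- x\<^sup>r\<close>.\<close>
lemma sum_quad_form_powr_ge:
  assumes A: "A \<in> psd_cone n" and U: "unitary_mat n U" and r: "0 < r" "r \<le> 1"
  shows "trace_power A r \<le> (\<Sum>i<n. quad_form A (col U i) powr r)"
proof -
  obtain V a where V: "unitary_mat n V" "A = unitary_conj_diag n V a" "\<And>i. i < n \<Longrightarrow> 0 \<le> a i"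
    using psd_diagonalization[OF A] by blast
  then show ?thesis
    using Peierls_inequality[OF U V(1) _ powr_concave_nonneg[OF r, unfolded concave_on_def], of a] r
    by (simp add: trace_power_unitary_conj_diag sum_negf)
qed

text \<open>In an eigenbasis of the combination, its trace power is a sum of powers of quadratic forms,
  to which scalar concavity applies. Peierls' inequality then replaces the quadratic forms of
  the two given matrices by their eigenvalues. For \<open>r = 0\<close> all three traces equal \<open>n\<close> by the
  convention \<open>Z\<^sup>0 = I\<close>.\<close>
lemma trace_power_concave:
  assumes A: "A \<in> psd_cone n" and B: "B \<in> psd_cone n" and t: "0 \<le> t" "t \<le> 1"
    and r: "0 \<le> r" "r \<le> 1"
  shows "t * trace_power A r + (1 - t) * trace_power B r
    \<le> trace_power (complex_of_real t \<cdot>\<^sub>m A + complex_of_real (1 - t) \<cdot>\<^sub>m B) r"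
proof -
  define C where "C = complex_of_real t \<cdot>\<^sub>m A + complex_of_real (1 - t) \<cdot>\<^sub>m B"
  have C: "C \<in> psd_cone n" unfolding C_def using t by (intro psd_cone_combine[OF A B]) auto
  note c = psd_carrier[OF A] psd_carrier[OF B]
  show ?thesis
  proof (cases "r = 0")
    case True
    have "trace_power X 0 = n" if "X \<in> psd_cone n" for X
      using that by (rule psd_diagonalization) (simp add: trace_power_unitary_conj_diag)
    then have "trace_power A r = n" "trace_power B r = n" "trace_power C r = n"
      using A B C True by auto
    then show ?thesis by (simp add: C_def algebra_simps)
  next
    case False
    then have r: "0 < r" "r \<le> 1" using r by auto
    obtain U d where U: "unitary_mat n U" and C_eq: "C = unitary_conj_diag n U d"
      using psd_diagonalization[OF C] by blast
    note u = unitary_col_carrier[OF U]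
    have "t * trace_power A r + (1 - t) * trace_power B r
      \<le> t * (\<Sum>i<n. quad_form A (col U i) powr r) + (1 - t) * (\<Sum>i<n. quad_form B (col U i) powr r)"
      using t by (intro add_mono mult_left_mono sum_quad_form_powr_ge[OF A U r]
          sum_quad_form_powr_ge[OF B U r]) auto
    also have "\<dots> = (\<Sum>i<n. t * quad_form A (col U i) powr r + (1 - t) * quad_form B (col U i) powr r)"
      by (simp add: sum.distrib sum_distrib_left)
    also have "\<dots> \<le> (\<Sum>i<n. quad_form C (col U i) powr r)"
    proof (rule sum_mono)
      fix i
      have "quad_form C (col U i) = (1 - t) *\<^sub>R quad_form B (col U i) + t *\<^sub>R quad_form A (col U i)"
        using c u[of i] by (simp add: C_def quad_form_add[of _ n] quad_form_smult[of _ n] del: of_real_diff)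
      moreover have "(1 - t) * quad_form B (col U i) powr r + t * quad_form A (col U i) powr r
          \<le> ((1 - t) *\<^sub>R quad_form B (col U i) + t *\<^sub>R quad_form A (col U i)) powr r"
        using convex_onD[OF powr_concave_nonneg[OF r, unfolded concave_on_def] t,
            of "quad_form B (col U i)" "quad_form A (col U i)"]
          quad_form_nonneg[OF A u] quad_form_nonneg[OF B u] by simp
      ultimately show "t * quad_form A (col U i) powr r + (1 - t) * quad_form B (col U i) powr r
          \<le> quad_form C (col U i) powr r" by simp
    qed
    also have "\<dots> = trace_power C r"
      using r by (simp add: C_eq quad_form_eigenvector[OF U] trace_power_unitary_conj_diag[OF U])
    finally show ?thesis by (simp add: C_def)
  qed
qed

text \<open>The triangle inequality for the Schatten \<open>r\<close>-norm on the positive cone: in an eigenbasis of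
  the sum it is the scalar Minkowski inequality, and by Peierls' inequality passing to the
  eigenvalues of the summands only enlarges the right-hand side.\<close>
lemma trace_power_Minkowski:
  assumes A: "A \<in> psd_cone n" and B: "B \<in> psd_cone n" and r: "1 \<le> r"
  shows "trace_power (A + B) r powr (1 / r)
    \<le> trace_power A r powr (1 / r) + trace_power B r powr (1 / r)"
proof -
  obtain U d where U: "unitary_mat n U" and S: "A + B = unitary_conj_diag n U d"
    using psd_diagonalization[OF psd_cone_add[OF A B]] by blast
  note u = unitary_col_carrier[OF U]
  have "trace_power (A + B) r = (\<Sum>i<n. quad_form (A + B) (col U i) powr r)"
    using r by (simp add: S quad_form_eigenvector[OF U] trace_power_unitary_conj_diag[OF U])
  also have "\<dots> = (\<Sum>i<n. (quad_form A (col U i) + quad_form B (col U i)) powr r)"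
    by (simp add: quad_form_add[OF psd_carrier[OF A] psd_carrier[OF B] u])
  also have "\<dots> powr (1 / r) \<le> (\<Sum>i<n. quad_form A (col U i) powr r) powr (1 / r)
      + (\<Sum>i<n. quad_form B (col U i) powr r) powr (1 / r)"
    using quad_form_nonneg[OF A u] quad_form_nonneg[OF B u] r by (intro sum_powr_Minkowski) auto
  also have "\<dots> \<le> trace_power A r powr (1 / r) + trace_power B r powr (1 / r)"
    using r by (intro add_mono powr_mono2 sum_quad_form_powr_le[OF A U]
        sum_quad_form_powr_le[OF B U]) (auto intro: sum_nonneg)
  finally show ?thesis .
qed

section \<open>Superadditivity of trace powers\<close>

text \<open>With \<open>S = A + B\<close> and an eigenvector \<open>v\<close> of \<open>A\<close> with eigenvalue \<open>a\<close>, this says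
  \<open>a \<langle>v, S\<^sup>-\<^sup>1 v\<rangle> \<le> 1\<close>, a consequence of \<open>a v v\<^sup>* \<le> A \<le> S\<close>. Testing that chain on
  \<open>y = S\<^sup>-\<^sup>1 v\<close> gives \<open>a Q\<^sup>2 \<le> Q\<close> for \<open>Q = \<langle>v, S\<^sup>-\<^sup>1 v\<rangle>\<close>.\<close>
lemma weighted_inverse_overlap_le_1:
  assumes A: "A \<in> psd_cone n" and B: "B \<in> psd_cone n"
    and V: "unitary_mat n V" "A = unitary_conj_diag n V a" "\<And>j. j < n \<Longrightarrow> 0 \<le> a j"
    and W: "unitary_mat n W" "A + B = unitary_conj_diag n W s" "\<And>k. k < n \<Longrightarrow> 0 \<le> s k"
    and j: "j < n"
  shows "a j * (\<Sum>k<n. (cmod (col V j \<bullet>c col W k))\<^sup>2 / s k) \<le> 1"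
proof -
  let ?v = "col V j" and ?w = "\<lambda>k. col W k"
  define Q where "Q = (\<Sum>k<n. (cmod (?v \<bullet>c ?w k))\<^sup>2 / s k)"
  \<comment> \<open>The vector \<open>y = (A + B)\<^sup>-\<^sup>1 v\<close>; division by zero gives \<open>0\<close>, so this is the
    pseudo-inverse when \<open>A + B\<close> is singular.\<close>
  define c where "c = vec n (\<lambda>k. (?v \<bullet>c ?w k) / complex_of_real (s k))"
  define y where "y = W *\<^sub>v c"
  have Wc: "W \<in> carrier_mat n n" "mat_adjoint W \<in> carrier_mat n n" "mat_adjoint W * W = 1\<^sub>m n"
    using W(1) by (auto simp: unitary_mat_def mat_adjoint_carrier)
  have v: "?v \<in> carrier_vec n" by (rule unitary_col_carrier[OF V(1)])
  have c: "c \<in> carrier_vec n" by (simp add: c_def)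
  have y: "y \<in> carrier_vec n" using Wc c by (simp add: y_def)
  have Q: "0 \<le> Q" using W(3) by (auto simp: Q_def intro!: sum_nonneg)
  have "mat_adjoint W *\<^sub>v y = c"
    using Wc c by (simp add: y_def assoc_mult_mat_vec[of _ n n _ n, symmetric])
  then have y_w: "y \<bullet>c ?w k = c $ k" if "k < n" for k
    using mat_adjoint_mult_vec_index[OF Wc(1) y that] by simp
  have "y \<bullet>c ?v = c \<bullet>c (mat_adjoint W *\<^sub>v ?v)"
    unfolding y_def using Wc c v by (intro mat_adjoint_cscalar) auto
  also have "\<dots> = (\<Sum>k<n. c $ k * cnj ((mat_adjoint W *\<^sub>v ?v) $ k))"
    using Wc by (simp add: scalar_prod_def lessThan_atLeast0 del: index_mult_mat_vec)
  also have "\<dots> = (\<Sum>k<n. complex_of_real ((cmod (?v \<bullet>c ?w k))\<^sup>2 / s k))"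
    by (intro sum.cong refl)
      (simp add: mat_adjoint_mult_vec_index[OF Wc(1) v] c_def complex_mult_cnj_cmod
        del: index_mult_mat_vec)
  finally have y_v: "y \<bullet>c ?v = complex_of_real Q" by (simp add: Q_def)
  have "a j * Q\<^sup>2 = a j * (cmod (y \<bullet>c col V j))\<^sup>2" using Q by (simp add: y_v)
  also have "\<dots> \<le> quad_form A y"
    unfolding V(2) quad_form_unitary_conj_diag[OF V(1) y]
    using j V(3) by (intro member_le_sum) auto
  also have "\<dots> \<le> quad_form (A + B) y"
    using quad_form_nonneg[OF B y] by (simp add: quad_form_add[OF psd_carrier[OF A] psd_carrier[OF B] y])
  also have "\<dots> = (\<Sum>k<n. s k * (cmod (c $ k))\<^sup>2)"
    unfolding W(2) quad_form_unitary_conj_diag[OF W(1) y] by (simp add: y_w)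
  also have "\<dots> = Q"
    unfolding Q_def using W(3)
    by (intro sum.cong refl) (simp add: c_def norm_divide power_divide power2_eq_square)
  finally have "a j * Q * Q \<le> 1 * Q" by (simp add: power2_eq_square mult.assoc)
  then have "a j * Q \<le> 1"
    using Q by (cases "Q = 0") (auto dest: mult_right_le_imp_le)
  then show ?thesis by (simp add: Q_def)
qed

text \<open>With \<open>S = A + B\<close> this is \<open>Tr A\<^sup>r \<le> Tr A S\<^sup>r\<^sup>-\<^sup>1\<close>. Each eigenvalue \<open>a\<^sub>j\<close> of \<open>A\<close> is a
  combination of the eigenvalues \<open>s\<^sub>k\<close> of \<open>S\<close> with weights
  \<open>m\<^sub>j\<^sub>k = a\<^sub>j \<bar>\<langle>v\<^sub>j, w\<^sub>k\<rangle>\<bar>\<^sup>2 / s\<^sub>k\<close>, whose sum over \<open>k\<close> is at most one; Jensen then bounds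
  \<open>a\<^sub>j\<^sup>r\<close>.\<close>
lemma trace_power_le_weighted_quad_form:
  assumes A: "A \<in> psd_cone n" and B: "B \<in> psd_cone n"
    and W: "unitary_mat n W" "A + B = unitary_conj_diag n W s" "\<And>k. k < n \<Longrightarrow> 0 \<le> s k"
    and r: "1 \<le> r"
  shows "trace_power A r \<le> (\<Sum>k<n. quad_form A (col W k) * s k powr (r - 1))"
proof -
  obtain V a where V: "unitary_mat n V" "A = unitary_conj_diag n V a" "\<And>j. j < n \<Longrightarrow> 0 \<le> a j"
    using psd_diagonalization[OF A] by blast
  note v = unitary_col_carrier[OF V(1)] and w = unitary_col_carrier[OF W(1)]
  define P where "P j k = (cmod (col V j \<bullet>c col W k))\<^sup>2" for j k
  have form: "quad_form A (col W k) = (\<Sum>j<n. a j * P j k)" for k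
    unfolding V(2) quad_form_unitary_conj_diag[OF V(1) w] P_def
    by (simp add: cmod_cscalar_commute[OF w v])
  \<comment> \<open>The kernel of \<open>A + B\<close> lies in that of \<open>A\<close>, so division by \<open>s k\<close> below loses nothing.\<close>
  have s_zero: "a j * P j k = 0" if "j < n" "k < n" "s k = 0" for j k
  proof -
    have "a j * P j k \<le> quad_form A (col W k)"
      unfolding form using that V(3) by (intro member_le_sum) (auto simp: P_def)
    also have "\<dots> \<le> quad_form (A + B) (col W k)"
      using quad_form_nonneg[OF B w[of k]]
      by (simp add: quad_form_add[OF psd_carrier[OF A] psd_carrier[OF B] w])
    also have "\<dots> = 0" using that by (simp add: W(2) quad_form_eigenvector[OF W(1)])
    finally have "a j * P j k \<le> 0" .
    moreover have "0 \<le> a j * P j k" using V(3)[OF that(1)] by (simp add: P_def)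
    ultimately show ?thesis by (rule order_antisym)
  qed
  have bound: "a j powr r \<le> (\<Sum>k<n. a j * P j k * s k powr (r - 1))" if j: "j < n" for j
  proof -
    define m where "m k = a j * P j k / s k" for k
    have m: "0 \<le> m k" if "k < n" for k
      using V(3)[OF j] W(3)[OF that] by (simp add: m_def P_def)
    have "sum m {..<n} = a j * (\<Sum>k<n. P j k / s k)"
      by (simp add: m_def sum_distrib_left)
    then have m_le: "sum m {..<n} \<le> 1"
      using weighted_inverse_overlap_le_1[OF A B V W j] by (simp add: P_def)
    have "(\<Sum>k<n. P j k) = 1"
      unfolding P_def unitary_mat_Parseval[OF W(1) v]
      using unitary_mat_orthonormal_cols[OF V(1) j j] by simp
    then have "a j = (\<Sum>k<n. a j * P j k)" by (simp add: sum_distrib_left[symmetric])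
    also have "\<dots> = (\<Sum>k<n. m k * s k)"
      using s_zero[OF j] by (intro sum.cong refl) (auto simp: m_def)
    finally have "a j powr r = (\<Sum>k<n. m k * s k) powr r" by simp
    also have "\<dots> \<le> (\<Sum>k<n. m k * s k powr r)"
      using m m_le W(3) r by (intro powr_substochastic_Jensen) auto
    also have "\<dots> = (\<Sum>k<n. a j * P j k * s k powr (r - 1))"
    proof (intro sum.cong refl)
      fix k assume "k \<in> {..<n}"
      then show "m k * s k powr r = a j * P j k * s k powr (r - 1)"
        using W(3)[of k] by (cases "s k = 0") (auto simp: m_def powr_diff)
    qed
    finally show ?thesis .
  qed
  have "trace_power A r = (\<Sum>j<n. a j powr r)"
    using r by (simp add: V(2) trace_power_unitary_conj_diag[OF V(1)])
  also have "\<dots> \<le> (\<Sum>j<n. \<Sum>k<n. a j * P j k * s k powr (r - 1))"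
    by (intro sum_mono bound) simp
  also have "\<dots> = (\<Sum>k<n. \<Sum>j<n. a j * P j k * s k powr (r - 1))"
    by (rule sum.swap)
  also have "\<dots> = (\<Sum>k<n. quad_form A (col W k) * s k powr (r - 1))"
    by (simp add: form sum_distrib_right)
  finally show ?thesis .
qed

text \<open>McCarthy's inequality: the bounds \<open>Tr A S\<^sup>r\<^sup>-\<^sup>1\<close> and \<open>Tr B S\<^sup>r\<^sup>-\<^sup>1\<close> add up to \<open>Tr S\<^sup>r\<close>
  because \<open>A + B = S\<close>.\<close>
lemma trace_power_superadditive:
  assumes A: "A \<in> psd_cone n" and B: "B \<in> psd_cone n" and r: "1 \<le> r"
  shows "trace_power A r + trace_power B r \<le> trace_power (A + B) r"
proof -
  obtain W s where W: "unitary_mat n W" "A + B = unitary_conj_diag n W s"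
    "\<And>k. k < n \<Longrightarrow> 0 \<le> s k"
    using psd_diagonalization[OF psd_cone_add[OF A B]] by blast
  note w = unitary_col_carrier[OF W(1)]
  have comm: "B + A = A + B"
    using psd_carrier[OF A] psd_carrier[OF B] by (rule comm_add_mat[symmetric])
  have "trace_power A r + trace_power B r
      \<le> (\<Sum>k<n. quad_form A (col W k) * s k powr (r - 1))
        + (\<Sum>k<n. quad_form B (col W k) * s k powr (r - 1))"
    using W r by (intro add_mono trace_power_le_weighted_quad_form[OF A B]
        trace_power_le_weighted_quad_form[OF B A]) (auto simp: comm)
  also have "\<dots> = (\<Sum>k<n. s k * s k powr (r - 1))"
    unfolding sum.distrib[symmetric]
  proof (intro sum.cong refl)
    fix k assume "k \<in> {..<n}"
    then have "quad_form A (col W k) + quad_form B (col W k) = s k"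
      unfolding quad_form_add[OF psd_carrier[OF A] psd_carrier[OF B] w, symmetric] W(2)
      by (simp add: quad_form_eigenvector[OF W(1)])
    then show "quad_form A (col W k) * s k powr (r - 1) + quad_form B (col W k) * s k powr (r - 1)
        = s k * s k powr (r - 1)" by (simp add: distrib_right[symmetric])
  qed
  also have "\<dots> = (\<Sum>k<n. s k powr r)"
  proof (intro sum.cong refl)
    fix k assume "k \<in> {..<n}"
    then show "s k * s k powr (r - 1) = s k powr r"
      using W(3)[of k] by (cases "s k = 0") (auto simp: powr_diff)
  qed
  also have "\<dots> = trace_power (A + B) r"
    using r by (simp add: W(2) trace_power_unitary_conj_diag[OF W(1)])
  finally show ?thesis .
qed

section \<open>The inequality for the two mixtures\<close>

theorem corollary2p4:
  fixes n :: nat and A B :: "complex mat" and x p q :: real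
  assumes "n \<ge> 1"
    and "A \<in> psd_cone n" and "B \<in> psd_cone n"
    and "0 < x" and "x < 1"
    and "p \<ge> 1" and "1 \<ge> q" and "q \<ge> 0"
  shows "(Re (mat_trace (psd_power A (p * q))) + Re (mat_trace (psd_power B (p * q)))) powr (1 / p)
    \<le> Re (mat_trace (psd_power
          (complex_of_real x \<cdot>\<^sub>m A + complex_of_real (1 - x) \<cdot>\<^sub>m B) (p * q))) powr (1 / p)
      + Re (mat_trace (psd_power
          (complex_of_real (1 - x) \<cdot>\<^sub>m A + complex_of_real x \<cdot>\<^sub>m B) (p * q))) powr (1 / p)"
proof -
  define r where "r = p * q"
  define C where "C = complex_of_real x \<cdot>\<^sub>m A + complex_of_real (1 - x) \<cdot>\<^sub>m B"
  define D where "D = complex_of_real (1 - x) \<cdot>\<^sub>m A + complex_of_real x \<cdot>\<^sub>m B"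
  note A = \<open>A \<in> psd_cone n\<close> and B = \<open>B \<in> psd_cone n\<close>
  have C: "C \<in> psd_cone n" and D: "D \<in> psd_cone n"
    unfolding C_def D_def using assms by (auto intro!: psd_cone_combine simp del: of_real_diff)
  note nonneg = trace_power_nonneg[OF A] trace_power_nonneg[OF B]
    trace_power_nonneg[OF C] trace_power_nonneg[OF D]
  have "(trace_power A r + trace_power B r) powr (1 / p)
      \<le> trace_power C r powr (1 / p) + trace_power D r powr (1 / p)"
  proof (cases "r \<le> 1")
    case True
    have r: "0 \<le> r" using assms by (simp add: r_def)
    have "x * trace_power A r + (1 - x) * trace_power B r \<le> trace_power C r"
      unfolding C_def using assms True r by (intro trace_power_concave) auto
    moreover have "(1 - x) * trace_power A r + x * trace_power B r \<le> trace_power D r"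
      using trace_power_concave[OF A B, of "1 - x" r] assms True r by (simp add: D_def)
    ultimately have "trace_power A r + trace_power B r \<le> trace_power C r + trace_power D r"
      by (simp add: algebra_simps)
    then have "(trace_power A r + trace_power B r) powr (1 / p)
        \<le> (trace_power C r + trace_power D r) powr (1 / p)"
      using nonneg assms by (intro powr_mono2) auto
    also have "\<dots> \<le> trace_power C r powr (1 / p) + trace_power D r powr (1 / p)"
      using nonneg assms by (intro powr_subadditive) auto
    finally show ?thesis .
  next
    case False
    have q: "0 < q" using False assms by (cases "q = 0") (auto simp: r_def)
    \<comment> \<open>\<open>1 / p = q / r\<close>, so taking the power \<open>1 / p\<close> of \<open>Tr Z\<^sup>r\<close> amounts to taking the
      Schatten \<open>r\<close>-norm of \<open>Z\<close> and then its power \<open>q\<close>.\<close>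
    have split: "t powr (1 / p) = (t powr (1 / r)) powr q" for t
      using q assms by (simp add: powr_powr r_def)
    have CD: "A + B = C + D"
      using psd_carrier[OF A] psd_carrier[OF B]
      by (intro eq_matI) (auto simp: C_def D_def algebra_simps)
    have "trace_power A r + trace_power B r \<le> trace_power (C + D) r"
      using trace_power_superadditive[OF A B] False by (simp add: CD)
    then have "(trace_power A r + trace_power B r) powr (1 / p) \<le> trace_power (C + D) r powr (1 / p)"
      using nonneg assms by (intro powr_mono2) auto
    also have "\<dots> \<le> (trace_power C r powr (1 / r) + trace_power D r powr (1 / r)) powr q"
      unfolding split using False q
      by (intro powr_mono2 trace_power_Minkowski[OF C D]) auto
    also have "\<dots> \<le> trace_power C r powr (1 / p) + trace_power D r powr (1 / p)"
      unfolding split using assms by (intro powr_subadditive) auto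
    finally show ?thesis .
  qed
  then show ?thesis by (simp only: r_def C_def D_def)
qed

end
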